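(* Let $x^* \in \operatorname{dom} f$ be a point of local minimum of the problem $(\mathcal{P})$, and suppose that the function $x \mapsto d(y_0, \Phi(x))$ is continuous at $x^*$. Then the penalty function $$F_{\lambda}(x, \varepsilon) = f(x) + \varepsilon^{-1} d(y_0, \Phi(x))^2 + \lambda \varepsilon \quad (\varepsilon > 0)$$ is exact at $x^*$ if and only if the penalty function $G_{\sigma}(x) = f(x) + \sigma d(y_0, \Phi(x))$ is exact at $x^*$, and (in this case) $$\lambda^*(x^* ) = \frac{\sigma^*(x^* )^2}{4},$$ where $\lambda^*(x^* )$ and $\sigma^*(x^* )$ are the exact penalty parameters at $x^*$ of $F_\lambda$ and $G_\sigma$, respectively.
   Context: Setting: $X$ is a topological space, $(Y,d)$ is a metric space, $f \colon X \to \mathbb{R} \cup \{+\infty\}$, $\Phi \colon X \rightrightarrows Y$ is a set-valued mapping with closed values, $A \subset X$ is nonempty, $y_0 \in Y$ is fixed. Problem $(\mathcal{P})$: minimize $f(x)$ subject to $y_0 \in \Phi(x)$, $x \in A$. The feasible set is $\Omega = \{x \in A \mid y_0 \in \Phi(x)\}$; $\operatorname{dom} f = \{x \in X \mid f(x) < +\infty\}$. It is assumed that $\Omega \cap \operatorname{dom} f \neq \emptyset$ and $f$ is bounded below on $\Omega$. A local minimum of $(\mathcal{P})$ is a point of $\Omega$ that is a local minimizer of $f$ on $\Omega$. Here $d(y_0,\Phi(x)) = \inf_{z \in \Phi(x)} d(y_0,z)$ ($=+\infty$ if $\Phi(x)=\emptyset$). $\mathbb{R}_+ = [0,+\infty)$.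 Convention at $\varepsilon = 0$: $F_\lambda(x,0) = f(x)$ if $x$ is feasible, and $F_\lambda(x,0) = +\infty$ otherwise. Local exactness of a function of $(x,\varepsilon)$: $F_\lambda$ is exact at a local minimum $x^* \in \operatorname{dom} f$ of $(\mathcal{P})$ if there exists $\lambda \ge 0$ such that $(x^*,0)$ is a point of local minimum of $F_\lambda$ on $A \times \mathbb{R}_+$; the greatest lower bound $\lambda^*(x^* )$ of all such $\lambda$ is the exact penalty parameter of $F_\lambda$ at $x^*$. Local exactness of a function of $x$ only: $G_\sigma$ is exact at $x^*$ if there exists $\sigma \ge 0$ such that $x^*$ is a point of local minimum of $G_\sigma$ on $A$; the greatest lower bound $\sigma^*(x^* )$ of all such $\sigma$ is its exact penalty parameter at $x^*$. *)

theory Defs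
  imports "HOL-Analysis.Analysis"
begin

(* Extended-valued, unlike the library's infdist: the infimum over the empty set is +\<infinity>,
   whereas infdist y {} = 0. *)
definition set_distance :: "'b::metric_space \<Rightarrow> 'b set \<Rightarrow> ereal" where
  "set_distance y S = (INF z\<in>S. ereal (dist y z))"

definition local_min_on :: "('c::topological_space \<Rightarrow> ereal) \<Rightarrow> 'c set \<Rightarrow> 'c \<Rightarrow> bool" where
  "local_min_on g S x \<longleftrightarrow> x \<in> S \<and> (\<exists>U. open U \<and> x \<in> U \<and> (\<forall>z\<in>U \<inter> S. g x \<le> g z))"

definition eff_dom :: "('a \<Rightarrow> ereal) \<Rightarrow> 'a set" where
  "eff_dom f = {x. f x < \<infinity>}"

definition feasible_set :: "('a \<Rightarrow> 'b set) \<Rightarrow> 'a set \<Rightarrow> 'b \<Rightarrow> 'a set" where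
  "feasible_set \<Phi> A y0 = {x \<in> A. y0 \<in> \<Phi> x}"

(* Only the values on A \<times> {0..} are meaningful. *)
definition smooth_penalty ::
    "('a \<Rightarrow> ereal) \<Rightarrow> ('a \<Rightarrow> 'b::metric_space set) \<Rightarrow> 'a set \<Rightarrow> 'b \<Rightarrow> real \<Rightarrow> 'a \<times> real \<Rightarrow> ereal" where
  "smooth_penalty f \<Phi> A y0 lam = (\<lambda>(x, \<epsilon>).
     if \<epsilon> = 0 then (if x \<in> feasible_set \<Phi> A y0 then f x else \<infinity>)
     else f x + ereal (inverse \<epsilon>) * (set_distance y0 (\<Phi> x))^2 + ereal (lam * \<epsilon>))"

(* In ereal, 0 * \<infinity> = 0, so for \<sigma> = 0 this is f itself, also where the distance is infinite. *)
definition linear_penalty ::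
    "('a \<Rightarrow> ereal) \<Rightarrow> ('a \<Rightarrow> 'b::metric_space set) \<Rightarrow> 'b \<Rightarrow> real \<Rightarrow> 'a \<Rightarrow> ereal" where
  "linear_penalty f \<Phi> y0 \<sigma> x = f x + ereal \<sigma> * set_distance y0 (\<Phi> x)"

(* H is a family of penalty functions indexed by the penalty parameter. *)
definition exact_at :: "(real \<Rightarrow> 'c::topological_space \<Rightarrow> ereal) \<Rightarrow> 'c set \<Rightarrow> 'c \<Rightarrow> bool" where
  "exact_at H S x \<longleftrightarrow> (\<exists>c\<ge>0. local_min_on (H c) S x)"

(* A real infimum: only meaningful if exact_at H S x, since otherwise the set is empty. *)
definition exact_penalty_parameter ::
    "(real \<Rightarrow> 'c::topological_space \<Rightarrow> ereal) \<Rightarrow> 'c set \<Rightarrow> 'c \<Rightarrow> real" where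
  "exact_penalty_parameter H S x = Inf {c. 0 \<le> c \<and> local_min_on (H c) S x}"

end

theory Submission imports Defs begin

text \<open>
  Minimising the smooth penalty over \<open>\<epsilon>\<close> gives the linear one. Write \<open>D\<close> for the distance
  \<open>d(y0, \<Phi> x)\<close>. For \<open>c > 0\<close>, the arithmetic-geometric mean inequality
  \<open>D\<^sup>2 / \<epsilon> + c \<epsilon> \<ge> 2 \<surd>c D\<close> is an equality, if \<open>0 < D < \<infinity>\<close>, precisely at
  \<open>\<epsilon> = D / \<surd>c\<close>. Continuity of the distance, which
  vanishes at the feasible point \<open>x\<^sup>*\<close>, makes this optimal \<open>\<epsilon>\<close> as small as desired for \<open>x\<close> close
  to \<open>x\<^sup>*\<close>, so it is seen by every neighbourhood of \<open>(x\<^sup>*, 0)\<close>. Hence, for \<open>c > 0\<close>, the point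
  \<open>(x\<^sup>*, 0)\<close> is a local minimum of \<open>F\<^sub>c\<close> if and only if \<open>x\<^sup>*\<close> is a local minimum of \<open>G\<^sub>\<sigma>\<close> with
  \<open>\<sigma> = 2 \<surd>c\<close> (lemma \<open>smooth_local_min_iff_linear\<close>).

  At \<open>c = 0\<close> this correspondence fails: for \<open>f x = - x\<^sup>2\<close> and \<open>D = \<bar>x\<bar>\<close> the function \<open>F\<^sub>0\<close> has a local
  minimum at \<open>(0, 0)\<close>, while \<open>0\<close> is a strict local maximum of \<open>G\<^sub>0 = f\<close>. This is harmless, since
  both sets of admissible parameters are upward closed, so that neither exactness nor the infimum
  depends on whether \<open>0\<close> belongs to them. The substitution \<open>\<sigma> = 2 \<surd>c\<close> between the two sets then
  transforms one infimum into the other (lemma \<open>Inf_eq_square_quarter_Inf\<close>).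
\<close>

section \<open>Distance to a set\<close>

lemma set_distance_nonneg: "0 \<le> set_distance y S"
  unfolding set_distance_def by (rule INF_greatest) simp

lemma set_distance_eq_0_if_mem:
  assumes "y \<in> S"
  shows "set_distance y S = 0"
proof (rule antisym)
  show "set_distance y S \<le> 0"
    unfolding set_distance_def using INF_lower[OF assms, of "\<lambda>z. ereal (dist y z)"]
    by (simp add: zero_ereal_def)
qed (rule set_distance_nonneg)

lemma mem_if_set_distance_eq_0:
  assumes "closed S" "set_distance y S = 0"
  shows "y \<in> S"
proof -
  have "\<exists>z\<in>S. dist z y < e" if "e > 0" for e
  proof -
    have "(INF z\<in>S. ereal (dist y z)) < ereal e"
      using assms(2) that by (simp add: set_distance_def)
    then show ?thesis
      by (auto simp: INF_less_iff dist_commute)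
  qed
  then have "y \<in> closure S"
    by (auto simp: closure_approachable)
  with assms(1) show ?thesis by simp
qed

section \<open>The arithmetic-geometric mean inequality\<close>

lemma am_gm_ereal:
  fixes D :: ereal
  assumes "0 \<le> D" "0 < e" "0 \<le> c"
  shows "ereal (2 * sqrt c) * D \<le> ereal (inverse e) * D^2 + ereal (c * e)"
proof (cases D)
  case (real d)
  have "0 \<le> (d - sqrt c * e)^2" by simp
  also have "\<dots> = d^2 + (c * e) * e - 2 * sqrt c * d * e"
    using assms by (simp add: power2_diff power_mult_distrib power2_eq_square algebra_simps)
  finally have "2 * sqrt c * d * e \<le> d^2 + (c * e) * e"
    by simp
  also have "\<dots> = (inverse e * d^2 + c * e) * e"
    using assms(2) by (simp add: distrib_right)
  finally have "2 * sqrt c * d * e \<le> (inverse e * d^2 + c * e) * e" .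
  then have "2 * sqrt c * d \<le> inverse e * d^2 + c * e"
    using assms(2) by (simp only: mult_le_cancel_right_pos)
  then show ?thesis using real by simp
next
  case PInf
  then show ?thesis using assms by (simp add: power2_eq_square)
next
  case MInf
  then show ?thesis using assms by simp
qed

lemma am_gm_equality:
  assumes "0 < d" "0 < c"
  shows "inverse (d / sqrt c) * d^2 + c * (d / sqrt c) = 2 * sqrt c * d"
proof -
  have "sqrt c * sqrt c = c" "sqrt c > 0" using assms by simp_all
  then show ?thesis using assms
    by (simp add: field_simps power2_eq_square)
qed

section \<open>Local minima of the two penalty functions\<close>

lemma local_min_on_linear_penalty_iff:
  assumes "xs \<in> feasible_set \<Phi> A y0"
  shows "local_min_on (linear_penalty f \<Phi> y0 s) A xs \<longleftrightarrow>
    (\<exists>U. open U \<and> xs \<in> U \<and> (\<forall>x\<in>U \<inter> A. f xs \<le> f x + ereal s * set_distance y0 (\<Phi> x)))"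
  using assms
  by (auto simp: local_min_on_def linear_penalty_def feasible_set_def set_distance_eq_0_if_mem)

lemma local_min_on_linear_penalty_mono:
  assumes "xs \<in> feasible_set \<Phi> A y0" "s \<le> t"
    "local_min_on (linear_penalty f \<Phi> y0 s) A xs"
  shows "local_min_on (linear_penalty f \<Phi> y0 t) A xs"
proof -
  have "f x + ereal s * set_distance y0 (\<Phi> x) \<le> f x + ereal t * set_distance y0 (\<Phi> x)" for x
    using assms(2) by (intro add_left_mono ereal_mult_right_mono set_distance_nonneg) simp
  with assms(3) show ?thesis
    unfolding local_min_on_linear_penalty_iff[OF assms(1)] by (meson order_trans)
qed

text \<open>Neighbourhoods of \<open>(x\<^sup>*, 0)\<close> may be taken to be boxes \<open>U \<times> ]-\<delta>, \<delta>[\<close>, and the slice \<open>\<epsilon> = 0\<close>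
  constrains nothing beyond the given local minimality on the feasible set.\<close>

lemma local_min_on_smooth_penalty_iff:
  fixes f :: "'a::topological_space \<Rightarrow> ereal"
  assumes "local_min_on f (feasible_set \<Phi> A y0) xs"
  shows "local_min_on (smooth_penalty f \<Phi> A y0 c) (A \<times> {0..}) (xs, 0) \<longleftrightarrow>
    (\<exists>U \<delta>. open U \<and> xs \<in> U \<and> 0 < \<delta> \<and> (\<forall>x\<in>U \<inter> A. \<forall>\<epsilon>. 0 < \<epsilon> \<and> \<epsilon> < \<delta> \<longrightarrow>
       f xs \<le> f x + (ereal (inverse \<epsilon>) * (set_distance y0 (\<Phi> x))^2 + ereal (c * \<epsilon>))))"
    (is "?L \<longleftrightarrow> ?R")
proof
  have feas: "xs \<in> feasible_set \<Phi> A y0"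
    using assms by (simp add: local_min_on_def)
  {
    assume ?L
    then obtain W where W: "open W" "(xs, 0) \<in> W"
      and min: "\<And>z. z \<in> W \<inter> A \<times> {0..} \<Longrightarrow>
        smooth_penalty f \<Phi> A y0 c (xs, 0) \<le> smooth_penalty f \<Phi> A y0 c z"
      unfolding local_min_on_def by blast
    from W obtain U V where UV: "open U" "open V" "xs \<in> U" "0 \<in> V" "U \<times> V \<subseteq> W"
      by (auto elim: open_prod_elim)
    from UV(2,4) obtain \<delta> where \<delta>: "0 < \<delta>" "ball 0 \<delta> \<subseteq> V"
      by (auto elim: openE)
    have "f xs \<le> f x + (ereal (inverse \<epsilon>) * (set_distance y0 (\<Phi> x))^2 + ereal (c * \<epsilon>))"
      if "x \<in> U \<inter> A" "0 < \<epsilon>" "\<epsilon> < \<delta>" for x \<epsilon>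
    proof -
      have "\<epsilon> \<in> V" using \<delta>(2) that by (auto simp: subset_iff dist_real_def)
      then have "(x, \<epsilon>) \<in> W \<inter> A \<times> {0..}"
        using UV(5) that by auto
      from min[OF this] show ?thesis
        using feas that by (simp add: smooth_penalty_def add.assoc)
    qed
    with UV \<delta> show ?R by blast
  }
  {
    assume ?R
    then obtain U \<delta> where U: "open U" "xs \<in> U" "0 < \<delta>"
      and min: "\<And>x \<epsilon>. x \<in> U \<inter> A \<Longrightarrow> 0 < \<epsilon> \<Longrightarrow> \<epsilon> < \<delta> \<Longrightarrow>
        f xs \<le> f x + (ereal (inverse \<epsilon>) * (set_distance y0 (\<Phi> x))^2 + ereal (c * \<epsilon>))"
      by blast
    from assms obtain U' where U': "open U'" "xs \<in> U'"
      and min': "\<And>x. x \<in> U' \<inter> feasible_set \<Phi> A y0 \<Longrightarrow> f xs \<le> f x"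
      unfolding local_min_on_def by blast
    let ?W = "(U \<inter> U') \<times> {..<\<delta>}"
    have "smooth_penalty f \<Phi> A y0 c (xs, 0) \<le> smooth_penalty f \<Phi> A y0 c z"
      if z: "z \<in> ?W \<inter> A \<times> {0..}" for z
    proof -
      obtain x \<epsilon> where [simp]: "z = (x, \<epsilon>)" by (cases z)
      show ?thesis
        using z feas min[of x \<epsilon>] min'[of x]
        by (cases "\<epsilon> = 0") (auto simp: smooth_penalty_def add.assoc)
    qed
    moreover have "open ?W" "(xs, 0) \<in> ?W" "(xs, 0 :: real) \<in> A \<times> {0..}"
      using U U' feas by (auto intro!: open_Times simp: feasible_set_def)
    ultimately show ?L
      unfolding local_min_on_def by blast
  }
qed

lemma local_min_on_smooth_penalty_mono:
  fixes f :: "'a::topological_space \<Rightarrow> ereal"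
  assumes "local_min_on f (feasible_set \<Phi> A y0) xs" "b \<le> c"
    "local_min_on (smooth_penalty f \<Phi> A y0 b) (A \<times> {0..}) (xs, 0)"
  shows "local_min_on (smooth_penalty f \<Phi> A y0 c) (A \<times> {0..}) (xs, 0)"
proof -
  have "f x + (E + ereal (b * \<epsilon>)) \<le> f x + (E + ereal (c * \<epsilon>))" if "0 < \<epsilon>" for x E \<epsilon>
    using assms(2) that by (intro add_left_mono) simp
  with assms(3) show ?thesis
    unfolding local_min_on_smooth_penalty_iff[OF assms(1)] by (meson order_trans)
qed

lemma smooth_local_min_if_linear:
  fixes f :: "'a::topological_space \<Rightarrow> ereal"
  assumes "local_min_on f (feasible_set \<Phi> A y0) xs" "0 \<le> c"
    "local_min_on (linear_penalty f \<Phi> y0 (2 * sqrt c)) A xs"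
  shows "local_min_on (smooth_penalty f \<Phi> A y0 c) (A \<times> {0..}) (xs, 0)"
proof -
  have feas: "xs \<in> feasible_set \<Phi> A y0"
    using assms(1) by (simp add: local_min_on_def)
  have "f x + ereal (2 * sqrt c) * set_distance y0 (\<Phi> x)
      \<le> f x + (ereal (inverse \<epsilon>) * (set_distance y0 (\<Phi> x))^2 + ereal (c * \<epsilon>))"
    if "0 < \<epsilon>" for x \<epsilon>
    using that assms(2) by (intro add_left_mono am_gm_ereal set_distance_nonneg)
  then show ?thesis
    using assms(3) unfolding local_min_on_smooth_penalty_iff[OF assms(1)]
      local_min_on_linear_penalty_iff[OF feas]
    by (meson order_trans zero_less_one)
qed

text \<open>The converse substitutes the optimal \<open>\<epsilon> = D / \<surd>c\<close>. It must be positive and below the width \<open>\<delta>\<close>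
  of the neighbourhood; the former fails only where \<open>D = 0\<close>, that is, by closedness of the values,
  at feasible points, where local minimality for the original problem takes over.\<close>

lemma linear_local_min_if_smooth:
  fixes f :: "'a::topological_space \<Rightarrow> ereal"
  assumes lm: "local_min_on f (feasible_set \<Phi> A y0) xs"
    and cl: "\<And>x. closed (\<Phi> x)"
    and cont: "((\<lambda>x. set_distance y0 (\<Phi> x)) \<longlongrightarrow> set_distance y0 (\<Phi> xs)) (at xs)"
    and c: "0 < c"
    and smooth: "local_min_on (smooth_penalty f \<Phi> A y0 c) (A \<times> {0..}) (xs, 0)"
  shows "local_min_on (linear_penalty f \<Phi> y0 (2 * sqrt c)) A xs"
proof -
  let ?D = "\<lambda>x. set_distance y0 (\<Phi> x)"
  have feas: "xs \<in> feasible_set \<Phi> A y0"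
    using lm by (simp add: local_min_on_def)
  then have D0: "?D xs = 0"
    by (simp add: feasible_set_def set_distance_eq_0_if_mem)
  from smooth obtain U \<delta> where U: "open U" "xs \<in> U" "0 < \<delta>"
    and min: "\<And>x \<epsilon>. x \<in> U \<inter> A \<Longrightarrow> 0 < \<epsilon> \<Longrightarrow> \<epsilon> < \<delta> \<Longrightarrow>
      f xs \<le> f x + (ereal (inverse \<epsilon>) * (?D x)^2 + ereal (c * \<epsilon>))"
    unfolding local_min_on_smooth_penalty_iff[OF lm] by blast
  from lm obtain U' where U': "open U'" "xs \<in> U'"
    and min': "\<And>x. x \<in> U' \<inter> feasible_set \<Phi> A y0 \<Longrightarrow> f xs \<le> f x"
    unfolding local_min_on_def by blast
  have pos: "0 < ereal (\<delta> * sqrt c)"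
    using U(3) c by simp
  have "\<forall>\<^sub>F x in at xs. ?D x < ereal (\<delta> * sqrt c)"
    using order_tendstoD(2)[OF cont] D0 pos by simp
  then obtain V where V: "open V" "xs \<in> V"
    and small: "\<And>x. x \<in> V \<Longrightarrow> x \<noteq> xs \<Longrightarrow> ?D x < ereal (\<delta> * sqrt c)"
    unfolding eventually_at_topological by blast
  have "f xs \<le> f x + ereal (2 * sqrt c) * ?D x" if x: "x \<in> (U \<inter> U' \<inter> V) \<inter> A" for x
  proof (cases "?D x = 0")
    case True
    then have "x \<in> feasible_set \<Phi> A y0"
      using mem_if_set_distance_eq_0[OF cl] x by (simp add: feasible_set_def)
    with min' x True show ?thesis by simp
  next
    case False
    then have "?D x < ereal (\<delta> * sqrt c)"
      using small x D0 by auto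
    with False set_distance_nonneg[of y0 "\<Phi> x"]
    obtain d where d: "?D x = ereal d" "0 < d" "d < \<delta> * sqrt c"
      by (cases "?D x") (auto simp: less_le)
    have "0 < d / sqrt c" "d / sqrt c < \<delta>"
      using d c by (simp_all add: pos_divide_less_eq)
    with min[of x "d / sqrt c"] x
    have "f xs \<le> f x + (ereal (inverse (d / sqrt c)) * (?D x)^2 + ereal (c * (d / sqrt c)))"
      by simp
    also have "ereal (inverse (d / sqrt c)) * (?D x)^2 + ereal (c * (d / sqrt c))
        = ereal (inverse (d / sqrt c) * d^2 + c * (d / sqrt c))"
      by (simp add: d(1))
    also have "\<dots> = ereal (2 * sqrt c) * ?D x"
      using am_gm_equality[OF d(2) c] by (simp add: d(1))
    finally show ?thesis .
  qed
  moreover have "open (U \<inter> U' \<inter> V)" "xs \<in> U \<inter> U' \<inter> V"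
    using U U' V by auto
  ultimately show ?thesis
    unfolding local_min_on_linear_penalty_iff[OF feas] by blast
qed

lemma smooth_local_min_iff_linear:
  fixes f :: "'a::topological_space \<Rightarrow> ereal"
  assumes "local_min_on f (feasible_set \<Phi> A y0) xs"
    and "\<And>x. closed (\<Phi> x)"
    and "((\<lambda>x. set_distance y0 (\<Phi> x)) \<longlongrightarrow> set_distance y0 (\<Phi> xs)) (at xs)"
    and "0 < c"
  shows "local_min_on (smooth_penalty f \<Phi> A y0 c) (A \<times> {0..}) (xs, 0)
    \<longleftrightarrow> local_min_on (linear_penalty f \<Phi> y0 (2 * sqrt c)) A xs"
  using linear_local_min_if_smooth[OF assms] smooth_local_min_if_linear[OF assms(1)] assms(4)
  by auto

section \<open>Comparing the parameter sets\<close>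

lemma gt_Inf_imp_mem:
  fixes S :: "real set"
  assumes "S \<noteq> {}" "\<And>a b. a \<in> S \<Longrightarrow> a \<le> b \<Longrightarrow> b \<in> S" "Inf S < b"
  shows "b \<in> S"
  using cInf_lessD[OF assms(1,3)] assms(2) by (meson less_imp_le)

text \<open>Upward closed sets of nonnegative reals contain everything strictly above their infimum. So it
  suffices to test each infimum against strictly larger, hence positive, numbers, where the
  substitution is available.\<close>

lemma Inf_eq_square_quarter_Inf:
  fixes S T :: "real set"
  assumes ne: "S \<noteq> {}" "T \<noteq> {}"
    and nonneg: "S \<subseteq> {0..}" "T \<subseteq> {0..}"
    and up_S: "\<And>a b. a \<in> S \<Longrightarrow> a \<le> b \<Longrightarrow> b \<in> S"
    and up_T: "\<And>a b. a \<in> T \<Longrightarrow> a \<le> b \<Longrightarrow> b \<in> T"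
    and subst: "\<And>c. 0 < c \<Longrightarrow> c \<in> S \<longleftrightarrow> 2 * sqrt c \<in> T"
  shows "Inf S = (Inf T)^2 / 4"
proof -
  have bdd: "bdd_below S" "bdd_below T"
    using nonneg by (meson bdd_below_Ici bdd_below_mono)+
  have pos: "0 \<le> Inf S" "0 \<le> Inf T"
    using ne nonneg by (auto intro!: cInf_greatest)
  have "(Inf T)^2 / 4 \<le> Inf S"
  proof (rule dense_ge)
    fix c assume c: "Inf S < c"
    with pos have "0 < c" by simp
    then have "2 * sqrt c \<in> T"
      using gt_Inf_imp_mem[OF ne(1) up_S c] subst by simp
    then have "Inf T \<le> 2 * sqrt c"
      by (rule cInf_lower[OF _ bdd(2)])
    then have "(Inf T)^2 \<le> (2 * sqrt c)^2"
      using pos by (intro power_mono)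
    then show "(Inf T)^2 / 4 \<le> c"
      using \<open>0 < c\<close> by (simp add: power_mult_distrib)
  qed
  moreover have "2 * sqrt (Inf S) \<le> Inf T"
  proof (rule dense_ge)
    fix t assume t: "Inf T < t"
    with pos have "0 < t" by simp
    have "2 * sqrt (t^2 / 4) = t"
      using \<open>0 < t\<close> by (simp add: real_sqrt_divide)
    then have "t^2 / 4 \<in> S"
      using gt_Inf_imp_mem[OF ne(2) up_T t] subst[of "t^2 / 4"] \<open>0 < t\<close> by simp
    then have "Inf S \<le> t^2 / 4"
      by (rule cInf_lower[OF _ bdd(1)])
    then have "sqrt (Inf S) \<le> sqrt (t^2 / 4)"
      by (rule real_sqrt_le_mono)
    with \<open>2 * sqrt (t^2 / 4) = t\<close> show "2 * sqrt (Inf S) \<le> t"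
      by linarith
  qed
  then have "(2 * sqrt (Inf S))^2 \<le> (Inf T)^2"
    using pos by (intro power_mono) simp_all
  then have "Inf S \<le> (Inf T)^2 / 4"
    using pos by (simp add: power_mult_distrib)
  ultimately show ?thesis by simp
qed

section \<open>Exactness of the two penalty functions\<close>

theorem theorem1:
  fixes f :: "'a::topological_space \<Rightarrow> ereal"
    and \<Phi> :: "'a \<Rightarrow> 'b::metric_space set"
    and A :: "'a set"
    and y0 :: 'b
    and xs :: 'a
  assumes "\<And>x. f x \<noteq> -\<infinity>"
    and "\<And>x. closed (\<Phi> x)"
    and "A \<noteq> {}"
    and "feasible_set \<Phi> A y0 \<inter> eff_dom f \<noteq> {}"
    and "\<exists>m::real. \<forall>x\<in>feasible_set \<Phi> A y0. ereal m \<le> f x"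
    and "xs \<in> eff_dom f"
    and "local_min_on f (feasible_set \<Phi> A y0) xs"
    and "((\<lambda>x. set_distance y0 (\<Phi> x)) \<longlongrightarrow> set_distance y0 (\<Phi> xs)) (at xs)"
  shows "(exact_at (smooth_penalty f \<Phi> A y0) (A \<times> {0..}) (xs, 0)
            \<longleftrightarrow> exact_at (linear_penalty f \<Phi> y0) A xs)
       \<and> (exact_at (smooth_penalty f \<Phi> A y0) (A \<times> {0..}) (xs, 0) \<longrightarrow>
            exact_penalty_parameter (smooth_penalty f \<Phi> A y0) (A \<times> {0..}) (xs, 0)
              = (exact_penalty_parameter (linear_penalty f \<Phi> y0) A xs)^2 / 4)"
proof -
  note lm = assms(7)
  have feas: "xs \<in> feasible_set \<Phi> A y0"
    using lm by (simp add: local_min_on_def)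
  define S where
    "S = {c. 0 \<le> c \<and> local_min_on (smooth_penalty f \<Phi> A y0 c) (A \<times> {0..}) (xs, 0)}"
  define T where
    "T = {s. 0 \<le> s \<and> local_min_on (linear_penalty f \<Phi> y0 s) A xs}"
  have up_S: "b \<in> S" if "a \<in> S" "a \<le> b" for a b
    using that local_min_on_smooth_penalty_mono[OF lm] by (auto simp: S_def)
  have up_T: "b \<in> T" if "a \<in> T" "a \<le> b" for a b
    using that local_min_on_linear_penalty_mono[OF feas] by (auto simp: T_def)
  have subst: "c \<in> S \<longleftrightarrow> 2 * sqrt c \<in> T" if "0 < c" for c
    using smooth_local_min_iff_linear[OF lm assms(2,8) that] that by (simp add: S_def T_def)
  have exact_S: "exact_at (smooth_penalty f \<Phi> A y0) (A \<times> {0..}) (xs, 0) \<longleftrightarrow> S \<noteq> {}"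
    by (auto simp: exact_at_def S_def)
  have exact_T: "exact_at (linear_penalty f \<Phi> y0) A xs \<longleftrightarrow> T \<noteq> {}"
    by (auto simp: exact_at_def T_def)
  have iff: "S \<noteq> {} \<longleftrightarrow> T \<noteq> {}"
  proof
    assume "S \<noteq> {}"
    then obtain c where "c \<in> S" by blast
    \<comment> \<open>Adding \<open>1\<close> avoids the parameter \<open>0\<close>, where the substitution is not available.\<close>
    then have "c + 1 \<in> S" "0 < c + 1"
      using up_S[of c "c + 1"] by (auto simp: S_def)
    with subst show "T \<noteq> {}" by blast
  next
    assume "T \<noteq> {}"
    then obtain s where s: "s \<in> T" by blast
    then have "0 \<le> s" by (simp add: T_def)
    have "2 * sqrt (((s + 1) / 2)^2) = s + 1"
      using \<open>0 \<le> s\<close> by (simp only: real_sqrt_abs) simp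
    moreover have "0 < ((s + 1) / 2)^2"
      using \<open>0 \<le> s\<close> by simp
    ultimately have "((s + 1) / 2)^2 \<in> S"
      using subst up_T[OF s, of "s + 1"] by (metis less_add_one less_imp_le)
    then show "S \<noteq> {}" by blast
  qed
  have "Inf S = (Inf T)^2 / 4" if "S \<noteq> {}"
    by (rule Inf_eq_square_quarter_Inf)
      (use that iff up_S up_T subst in \<open>auto simp: S_def T_def\<close>)
  moreover have "exact_penalty_parameter (smooth_penalty f \<Phi> A y0) (A \<times> {0..}) (xs, 0) = Inf S"
    "exact_penalty_parameter (linear_penalty f \<Phi> y0) A xs = Inf T"
    by (simp_all add: exact_penalty_parameter_def S_def T_def)
  ultimately show ?thesis
    by (simp add: exact_S exact_T iff)
qed

end
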